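(* Let $A>0$, $B>0$ and inverse demand $P(Q)=A-BQ$. For linear costs $C_i(x_i)=cx_i$ with $0\le c<A$, let $\widetilde M=(A-c)/B$ and let $Q_n^{C,L}$, $Q_n^{S,L}$ be the aggregate equilibrium outputs of the $n$-firm Cournot and canonical hierarchical Stackelberg models. For quadratic costs $C_i(x_i)=cx_i^2$ with $c>0$, let $M=A/B$, $\delta=c/B$, and let $Q_n^{C,Q}$, $Q_n^{S,Q}$ be the corresponding aggregate equilibrium outputs. Define the normalized residuals $$R_n^{C,L}=\frac{\widetilde M-Q_n^{C,L}}{\widetilde M},\quad R_n^{S,L}=\frac{\widetilde M-Q_n^{S,L}}{\widetilde M},\quad R_n^{C,Q}=\frac{M-Q_n^{C,Q}}{M},\quad R_n^{S,Q}=\frac{M-Q_n^{S,Q}}{M}.$$ Then: 1. Under linear costs, $$R_n^{C,L}=\frac{1}{n+1},\qquad R_n^{S,L}=2^{-n},$$ and consequently $\displaystyle\lim_{n\to\infty}\frac{R_n^{S,L}}{R_n^{C,L}}=\lim_{n\to\infty}\frac{n+1}{2^n}=0$. 2. Under quadratic costs, $$R_n^{C,Q}=\frac{1+2\delta}{n+1+2\delta},\qquad\text{hence}\qquad R_n^{C,Q}\sim\frac{1+2\delta}{n}.$$ The Stackelberg residual satisfies $R_0^{S,Q}=1$ and $$R_n^{S,Q}=\frac{R_{n-1}^{S,Q}\bigl(R_{n-1}^{S,Q}+2\delta\bigr)}{2\bigl(R_{n-1}^{S,Q}+\delta\bigr)},\qquad n\ge1.$$ Moreover, $R_n^{S,Q}\sim\dfrac{2\delta}{n}$,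 and consequently $$\lim_{n\to\infty}\frac{R_n^{S,Q}}{R_n^{C,Q}}=\frac{2\delta}{1+2\delta}<1.$$
   Context: Firms $1,\dots,n$ choose outputs $x_i\ge0$; with $Q=\sum_j x_j$, firm $i$'s payoff is $\Pi_i(x_1,\dots,x_n)=x_i(A-BQ)-C_i(x_i)$. Cournot model: firms choose simultaneously; an equilibrium is a vector $(x_1,\dots,x_n)$ of nonnegative outputs in which each $x_i$ maximizes $\Pi_i$ over $[0,\infty)$ given the others' outputs. Canonical hierarchical Stackelberg model: firms choose sequentially in the order $1,2,\dots,n$, each observing all predecessors' outputs. A strategy of firm $k$ is a function $\sigma_k:[0,\infty)^{k-1}\to[0,\infty)$; the profile is a subgame-perfect equilibrium if for every $k$ and every history $(x_1,\dots,x_{k-1})$, $\sigma_k(x_1,\dots,x_{k-1})$ maximizes firm $k$'s payoff over $x_k\ge0$ when later firms follow $\sigma_{k+1},\dots,\sigma_n$. Equilibrium outputs are those along the path $x_k=\sigma_k(x_1,\dots,x_{k-1})$. Aggregate equilibrium output is the sum of the equilibrium outputs; for $n=0$ it is $0$. The notation $a_n\sim b_n$ means $a_n/b_n\to1$ as $n\to\infty$. *)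

theory Defs
  imports Complex_Main "HOL-Library.Landau_Symbols"
begin

text \<open>
  Firms are numbered from 1, so the output of firm \<open>i\<close> in an output vector \<open>xs\<close> is
  \<open>xs ! (i - 1)\<close>. A cost structure \<open>C\<close> gives firm \<open>i\<close> the cost function \<open>C i\<close>.
\<close>

definition output_vectors :: "nat \<Rightarrow> real list set" where
  "output_vectors n = {xs. length xs = n \<and> (\<forall>x\<in>set xs. 0 \<le> x)}"

definition payoff :: "real \<Rightarrow> real \<Rightarrow> (nat \<Rightarrow> real \<Rightarrow> real) \<Rightarrow> nat \<Rightarrow> real list \<Rightarrow> real" where
  "payoff A B C i xs = xs ! (i - 1) * (A - B * sum_list xs) - C i (xs ! (i - 1))"

definition cournot_equilibrium ::
    "real \<Rightarrow> real \<Rightarrow> (nat \<Rightarrow> real \<Rightarrow> real) \<Rightarrow> nat \<Rightarrow> real list \<Rightarrow> bool" where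
  "cournot_equilibrium A B C n xs \<longleftrightarrow>
     xs \<in> output_vectors n \<and>
     (\<forall>i\<in>{1..n}. is_arg_max (\<lambda>y. payoff A B C i (xs[i - 1 := y])) (\<lambda>y. 0 \<le> y) (xs ! (i - 1)))"

text \<open>
  A strategy profile \<open>\<sigma>\<close> maps a firm \<open>k\<close> and the list of the outputs of firms \<open>1, \<dots>, k - 1\<close>
  (in this order) to the output of firm \<open>k\<close>. Only the values on histories in
  \<open>output_vectors (k - 1)\<close> matter; there, nonnegativity of the chosen output is part of
  \<open>is_arg_max\<close> below. The term \<open>play \<sigma> m h\<close> is the output vector that results
  when the next \<open>m\<close> firms after the history \<open>h\<close> follow \<open>\<sigma>\<close>.
\<close>

primrec play :: "(nat \<Rightarrow> real list \<Rightarrow> real) \<Rightarrow> nat \<Rightarrow> real list \<Rightarrow> real list" where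
  "play \<sigma> 0 h = h"
| "play \<sigma> (Suc m) h = play \<sigma> m (h @ [\<sigma> (Suc (length h)) h])"

definition subgame_perfect ::
    "real \<Rightarrow> real \<Rightarrow> (nat \<Rightarrow> real \<Rightarrow> real) \<Rightarrow> nat \<Rightarrow> (nat \<Rightarrow> real list \<Rightarrow> real) \<Rightarrow> bool" where
  "subgame_perfect A B C n \<sigma> \<longleftrightarrow>
     (\<forall>k\<in>{1..n}. \<forall>h\<in>output_vectors (k - 1).
        is_arg_max (\<lambda>y. payoff A B C k (play \<sigma> (n - k) (h @ [y]))) (\<lambda>y. 0 \<le> y) (\<sigma> k h))"

definition is_cournot_aggregate ::
    "real \<Rightarrow> real \<Rightarrow> (nat \<Rightarrow> real \<Rightarrow> real) \<Rightarrow> nat \<Rightarrow> real \<Rightarrow> bool" where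
  "is_cournot_aggregate A B C n Q \<longleftrightarrow> (\<exists>xs. cournot_equilibrium A B C n xs \<and> Q = sum_list xs)"

definition is_stackelberg_aggregate ::
    "real \<Rightarrow> real \<Rightarrow> (nat \<Rightarrow> real \<Rightarrow> real) \<Rightarrow> nat \<Rightarrow> real \<Rightarrow> bool" where
  "is_stackelberg_aggregate A B C n Q \<longleftrightarrow>
     (\<exists>\<sigma>. subgame_perfect A B C n \<sigma> \<and> Q = sum_list (play \<sigma> n []))"

text \<open>
  The two descriptions below are meaningful only where the aggregate equilibrium output
  exists and is unique.
\<close>

definition cournot_aggregate ::
    "real \<Rightarrow> real \<Rightarrow> (nat \<Rightarrow> real \<Rightarrow> real) \<Rightarrow> nat \<Rightarrow> real" where
  "cournot_aggregate A B C n = (THE Q. is_cournot_aggregate A B C n Q)"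

definition stackelberg_aggregate ::
    "real \<Rightarrow> real \<Rightarrow> (nat \<Rightarrow> real \<Rightarrow> real) \<Rightarrow> nat \<Rightarrow> real" where
  "stackelberg_aggregate A B C n = (THE Q. is_stackelberg_aggregate A B C n Q)"

end

theory Submission
  imports Defs "HOL-Real_Asymp.Real_Asymp"
begin

text \<open>
  Both cost families have the form \<open>a * x + c * x\<^sup>2\<close>. With \<open>M = (A - a) / B\<close> and
  \<open>d = c / B\<close> a firm's payoff is \<open>B * (x * (M - Q - d * x))\<close>, so everything depends on the
  residual \<open>M - Q\<close> only. Linear costs are the case \<open>d = 0\<close>, and quadratic ones are
  the case \<open>a = 0\<close>.

  In the Stackelberg game the key fact is homogeneity: if a positive residual \<open>r\<close> is left when
  \<open>m\<close> firms are still to move, these firms shrink it to \<open>s\<^sub>m * r\<close>, for a factor \<open>s\<^sub>m\<close> that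
  depends on \<open>m\<close> and \<open>d\<close> alone. The firm that moves before them foresees this and maximizes
  \<open>y * (s\<^sub>m * (r - y) - d * y)\<close>, a concave quadratic whose maximizer is
  \<open>s\<^sub>m * r / (2 * (s\<^sub>m + d))\<close>; what it leaves over is again a fixed fraction of \<open>r\<close>, and the
  recursion for \<open>s\<close> in the theorem comes out. On histories with \<open>r \<le> 0\<close> every further
  output loses money, so all later firms stay out and the residual does not change. Hence the
  best reply is unique after every history (\<open>is_arg_max_iff_best_reply\<close>), and backward
  induction determines the equilibrium completely (\<open>subgame_perfect_iff_best_reply\<close>).

  A Cournot firm faces the same problem with no later firms. In
  equilibrium all outputs are therefore the same multiple of the residual, which gives one linear
  equation for \<open>Q\<close> (\<open>is_cournot_aggregate_iff\<close>).

  For the asymptotics, the recursion turns into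
  \<open>1 / s\<^sub>m\<^sub>+\<^sub>1 = 1 / s\<^sub>m + 1 / (s\<^sub>m + 2 * d)\<close>. As \<open>s\<^sub>m\<close> becomes small, the increments
  approach \<open>1 / (2 * d)\<close>, so that \<open>1 / s\<^sub>m\<close> grows like \<open>m / (2 * d)\<close>. The total shortfall
  of the increments is at most \<open>ln (1 / s\<^sub>m) / d\<close>
  (\<open>inverse_residual_share_log_ge\<close>), hence logarithmic in \<open>m\<close>.
\<close>

section \<open>The recursion for the residual share\<close>

text \<open>
  The factor \<open>s\<^sub>m\<close> by which \<open>m\<close> successive firms shrink a positive residual.
\<close>

primrec residual_share :: "real \<Rightarrow> nat \<Rightarrow> real" where
  "residual_share d 0 = 1"
| "residual_share d (Suc m) =
     residual_share d m * (residual_share d m + 2 * d) / (2 * (residual_share d m + d))"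

lemma residual_share_bounds:
  assumes "0 \<le> d"
  shows "0 < residual_share d m \<and> residual_share d m \<le> 1"
proof (induction m)
  case 0
  then show ?case by simp
next
  case (Suc m)
  let ?s = "residual_share d m"
  have "0 < (?s + 2 * d) / (2 * (?s + d))" "(?s + 2 * d) / (2 * (?s + d)) \<le> 1"
    using Suc assms by (auto simp: field_simps)
  then have "0 < ?s * ((?s + 2 * d) / (2 * (?s + d)))"
    "?s * ((?s + 2 * d) / (2 * (?s + d))) \<le> 1"
    using Suc by (auto intro!: mult_pos_pos mult_le_one simp del: times_divide_eq_right)
  then show ?case by simp
qed

lemma residual_share_pos: "0 \<le> d \<Longrightarrow> 0 < residual_share d m"
  and residual_share_le_1: "0 \<le> d \<Longrightarrow> residual_share d m \<le> 1"
  using residual_share_bounds by auto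

lemma residual_share_zero: "residual_share 0 m = 1 / 2 ^ m"
  by (induction m) auto

lemma inverse_residual_share_Suc:
  assumes "0 < d"
  shows "1 / residual_share d (Suc m) = 1 / residual_share d m + 1 / (residual_share d m + 2 * d)"
proof -
  let ?s = "residual_share d m"
  have s: "0 < ?s" using assms residual_share_pos by simp
  have "1 / residual_share d (Suc m) = 2 * (?s + d) / (?s * (?s + 2 * d))"
    by simp
  also have "\<dots> = 1 / ?s + 1 / (?s + 2 * d)"
    using s assms by (simp add: add_frac_eq)
  finally show ?thesis .
qed

lemma inverse_residual_share_le:
  assumes "0 < d"
  shows "1 / residual_share d m \<le> 1 + real m / (2 * d)"
proof (induction m)
  case 0
  then show ?case by simp
next
  case (Suc m)
  have "1 / (residual_share d m + 2 * d) \<le> 1 / (2 * d)"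
    using assms residual_share_pos[of d m] by (intro divide_left_mono) auto
  then show ?case
    using Suc unfolding inverse_residual_share_Suc[OF assms]
    by (simp add: add_divide_distrib)
qed

text \<open>
  One step lowers \<open>ln s\<close> by at least \<open>s / (2 * (s + 2 * d))\<close>. Divided by \<open>d\<close>, this is exactly
  the amount by which the increment \<open>1 / (s + 2 * d)\<close> of \<open>1 / s\<close> falls short of its limit
  \<open>1 / (2 * d)\<close>. So the logarithmic term compensates for all shortfalls.
\<close>

lemma inverse_residual_share_log_ge:
  assumes "0 < d"
  shows "1 + real m / (2 * d) \<le> 1 / residual_share d m - ln (residual_share d m) / d"
proof (induction m)
  case 0
  then show ?case by simp
next
  case (Suc m)
  let ?s = "residual_share d m" and ?t = "residual_share d (Suc m)"
  have s: "0 < ?s" and t: "0 < ?t" using assms residual_share_pos less_imp_le by blast+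
  have "ln ?t - ln ?s = ln (?t / ?s)"
    using s t by (simp add: ln_div del: residual_share.simps)
  also have "\<dots> \<le> ?t / ?s - 1"
    using s t by (intro ln_le_minus_one divide_pos_pos)
  also have "?t / ?s = (?s + 2 * d) / (2 * (?s + d))"
    using s by simp
  also have "\<dots> - 1 = - ?s / (2 * (?s + d))"
    using s assms by (simp add: field_simps)
  also have "\<dots> \<le> - ?s / (2 * (?s + 2 * d))"
    using s assms by (simp add: frac_le)
  finally have "?s / (2 * (?s + 2 * d)) / d \<le> (ln ?s - ln ?t) / d"
    using assms by (intro divide_right_mono) (auto simp del: residual_share.simps)
  moreover have "?s / (2 * (?s + 2 * d)) / d = 1 / (2 * d) - 1 / (?s + 2 * d)"
    using s assms by (simp add: field_simps)
  ultimately show ?case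
    using Suc unfolding inverse_residual_share_Suc[OF assms]
    by (simp add: add_divide_distrib diff_divide_distrib del: residual_share.simps)
qed

text \<open>
  The two preceding bounds enclose \<open>1 / s\<^sub>n\<close> between \<open>u - ln u / d\<close> and \<open>u\<close> for
  \<open>u = 1 + n / (2 * d)\<close>.
\<close>

lemma residual_share_asymp:
  assumes "0 < d"
  shows "residual_share d \<sim>[at_top] (\<lambda>n. 2 * d / real n)"
proof -
  define u where "u n = 1 + real n / (2 * d)" for n
  have upper: "1 / residual_share d n \<le> u n" for n
    using inverse_residual_share_le[OF assms] by (simp add: u_def)
  have lower: "u n - ln (u n) / d \<le> 1 / residual_share d n" for n
  proof -
    have pos: "0 < residual_share d n"
      using assms residual_share_pos by simp
    have "- ln (residual_share d n) = ln (1 / residual_share d n)"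
      using pos by (simp add: ln_div)
    also have "\<dots> \<le> ln (u n)"
      using pos upper[of n] by (intro ln_mono) auto
    finally have "- ln (residual_share d n) / d \<le> ln (u n) / d"
      using assms by (intro divide_right_mono) auto
    then show ?thesis
      using inverse_residual_share_log_ge[OF assms, of n] by (simp add: u_def)
  qed
  have "(\<lambda>n. (1 / residual_share d n) / (real n / (2 * d))) \<longlonglongrightarrow> 1"
  proof (rule tendsto_sandwich)
    show "\<forall>\<^sub>F n in sequentially. (u n - ln (u n) / d) / (real n / (2 * d))
            \<le> (1 / residual_share d n) / (real n / (2 * d))"
      using lower assms by (intro always_eventually allI divide_right_mono) auto
    show "\<forall>\<^sub>F n in sequentially. (1 / residual_share d n) / (real n / (2 * d))
            \<le> u n / (real n / (2 * d))"
      using upper assms by (intro always_eventually allI divide_right_mono) auto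
    show "(\<lambda>n. (u n - ln (u n) / d) / (real n / (2 * d))) \<longlonglongrightarrow> 1"
      unfolding u_def using assms by real_asymp
    show "(\<lambda>n. u n / (real n / (2 * d))) \<longlonglongrightarrow> 1"
      unfolding u_def using assms by real_asymp
  qed
  then have "(\<lambda>n. inverse ((1 / residual_share d n) / (real n / (2 * d)))) \<longlonglongrightarrow> inverse 1"
    by (rule tendsto_inverse) simp
  then show ?thesis
    by (intro asymp_equivI') (simp add: field_simps)
qed

section \<open>The best reply to later followers\<close>

text \<open>
  The residual at the end of the game if \<open>r\<close> is left when \<open>m\<close> firms are still to move. For
  \<open>r \<le> 0\<close> these firms produce nothing. Such histories lie off the equilibrium path, but a
  deviation can lead to them, so they enter every maximization.
\<close>

definition residual_after :: "real \<Rightarrow> nat \<Rightarrow> real \<Rightarrow> real" where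
  "residual_after d m r = (if 0 < r then residual_share d m * r else r)"

definition best_reply :: "real \<Rightarrow> nat \<Rightarrow> real \<Rightarrow> real" where
  "best_reply d m r = residual_share d m * max r 0 / (2 * (residual_share d m + d))"

lemma residual_after_0 [simp]: "residual_after d 0 r = r"
  by (simp add: residual_after_def)

lemma best_reply_nonneg: "0 \<le> d \<Longrightarrow> 0 \<le> best_reply d m r"
  using residual_share_pos[of d m] by (simp add: best_reply_def)

lemma best_reply_less:
  assumes "0 \<le> d" "0 < r"
  shows "best_reply d m r < r"
proof -
  have "residual_share d m * r < r * (2 * (residual_share d m + d))"
    using assms residual_share_pos[of d m] by (simp add: algebra_simps add_pos_nonneg)
  then show ?thesis
    using assms residual_share_pos[of d m] by (simp add: best_reply_def pos_divide_less_eq)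
qed

lemma residual_after_best_reply:
  assumes "0 \<le> d"
  shows "residual_after d m (r - best_reply d m r) = residual_after d (Suc m) r"
proof (cases "0 < r")
  case True
  let ?s = "residual_share d m"
  have s: "0 < ?s + d" using assms residual_share_pos[of d m] by simp
  have "r - best_reply d m r = r * ((?s + 2 * d) / (2 * (?s + d)))"
    using True s by (simp add: best_reply_def field_simps)
  then show ?thesis
    using True best_reply_less[OF assms True, of m] by (simp add: residual_after_def)
next
  case False
  then show ?thesis by (simp add: residual_after_def best_reply_def)
qed

text \<open>
  For \<open>r > 0\<close> the profit is majorized by the concave quadratic
  \<open>y * (s * (r - y) - d * y)\<close>: since \<open>s \<le> 1\<close>, extending the formula \<open>s * (r - y)\<close> beyond
  \<open>y = r\<close> only overstates the final residual there. The two agree at the vertex, because the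
  vertex lies below \<open>r\<close>; so the kink of \<open>residual_after\<close> does no harm.
\<close>

lemma profit_less_best_reply:
  assumes d: "0 \<le> d" and y: "0 \<le> y" "y \<noteq> best_reply d m r"
  defines "profit \<equiv> \<lambda>y. y * (residual_after d m (r - y) - d * y)"
  shows "profit y < profit (best_reply d m r)"
proof (cases "0 < r")
  case True
  let ?s = "residual_share d m" and ?x = "best_reply d m r"
  define g where "g = (\<lambda>y. y * (?s * (r - y) - d * y))"
  have s: "0 < ?s" "?s \<le> 1"
    using d residual_share_bounds by auto
  have "residual_after d m (r - y) \<le> ?s * (r - y)"
    using s mult_right_mono_neg[of ?s 1 "r - y"] by (simp add: residual_after_def)
  then have "profit y \<le> g y"
    unfolding profit_def g_def using y by (intro mult_left_mono) auto
  also have "g y < g ?x"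
  proof -
    have x: "?s * r = 2 * (?s + d) * ?x"
      using True s d by (simp add: best_reply_def)
    have "g z = z * (?s * r) - (?s + d) * z\<^sup>2" for z
      by (simp add: g_def algebra_simps power2_eq_square)
    note g = this
    have "g ?x - g y = (?s + d) * (y - ?x)\<^sup>2"
      unfolding g x by (simp add: algebra_simps power2_eq_square)
    moreover have "0 < (?s + d) * (y - ?x)\<^sup>2"
      using s d y by (intro mult_pos_pos) auto
    ultimately show ?thesis by simp
  qed
  also have "g ?x = profit ?x"
    using best_reply_less[OF d True, of m] by (simp add: g_def profit_def residual_after_def)
  finally show ?thesis .
next
  case False
  then have x: "best_reply d m r = 0" by (simp add: best_reply_def)
  then have "0 < y" using y by simp
  then have "y * (r - y - d * y) < 0"
    using False mult_nonneg_nonneg[OF d y(1)] by (intro mult_pos_neg) auto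
  then show ?thesis
    using x False \<open>0 < y\<close> by (simp add: profit_def residual_after_def)
qed

text \<open>
  Strictness in the previous lemma makes the maximizer unique; this is what forces the
  strategies of a subgame-perfect equilibrium, and hence the aggregate output.
\<close>

lemma is_arg_max_iff_best_reply:
  assumes d: "0 \<le> d" and B: "0 < B"
    and f: "\<And>y. 0 \<le> y \<Longrightarrow> f y = B * (y * (residual_after d m (r - y) - d * y))"
  shows "is_arg_max f (\<lambda>y. 0 \<le> y) x \<longleftrightarrow> x = best_reply d m r"
proof -
  have less: "f y < f (best_reply d m r)" if "0 \<le> y" "y \<noteq> best_reply d m r" for y
    using profit_less_best_reply[OF d that] B that(1)
    by (simp add: f best_reply_nonneg[OF d])
  show ?thesis
    unfolding is_arg_max_def
    using less best_reply_nonneg[OF d, of m r] by (metis less_asym')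
qed

lemma sum_list_update_real:
  fixes xs :: "real list"
  shows "i < length xs \<Longrightarrow> sum_list (xs[i := y]) = sum_list xs + y - xs ! i"
  by (induction xs arbitrary: i) (auto split: nat.split)

section \<open>Equilibria\<close>

lemma length_play [simp]: "length (play \<sigma> m h) = length h + m"
  by (induction m arbitrary: h) auto

lemma nth_play: "i < length h \<Longrightarrow> play \<sigma> m h ! i = h ! i"
  by (induction m arbitrary: h) (auto simp: nth_append)

locale quadratic_oligopoly =
  fixes A B a c :: real and C :: "nat \<Rightarrow> real \<Rightarrow> real"
  assumes B_pos: "0 < B" and a_less: "a < A" and c_nonneg: "0 \<le> c"
    and cost: "C i x = a * x + c * x\<^sup>2"
begin

definition M :: real where "M = (A - a) / B"
definition d :: real where "d = c / B"

lemma M_pos: "0 < M"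
  using B_pos a_less by (simp add: M_def)

lemma d_nonneg: "0 \<le> d"
  using B_pos c_nonneg by (simp add: d_def)

lemma payoff_eq:
  assumes "xs ! (i - 1) = y"
  shows "payoff A B C i xs = B * (y * (M - sum_list xs - d * y))"
  using B_pos assms by (simp add: payoff_def cost M_def d_def field_simps power2_eq_square)

subsection \<open>Cournot\<close>

text \<open>
  A Cournot firm sees the residual \<open>M - sum_list xs + xs ! j\<close> left by its rivals and has no
  followers, so its problem is that of the last firm in the sequential game.
\<close>

lemma cournot_iff_best_reply:
  "cournot_equilibrium A B C n xs \<longleftrightarrow>
     xs \<in> output_vectors n \<and> (\<forall>j<n. xs ! j = best_reply d 0 (M - sum_list xs + xs ! j))"
proof -
  have reply: "is_arg_max (\<lambda>y. payoff A B C i (xs[i - 1 := y])) (\<lambda>y. 0 \<le> y) (xs ! (i - 1)) \<longleftrightarrow>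
        xs ! (i - 1) = best_reply d 0 (M - sum_list xs + xs ! (i - 1))"
    if "xs \<in> output_vectors n" "i \<in> {1..n}" for i
  proof (rule is_arg_max_iff_best_reply[OF d_nonneg B_pos])
    fix y :: real
    have i: "i - 1 < length xs" using that by (auto simp: output_vectors_def)
    then have "sum_list (xs[i - 1 := y]) = sum_list xs + y - xs ! (i - 1)"
      by (rule sum_list_update_real)
    then have "M - sum_list (xs[i - 1 := y]) = M - sum_list xs + xs ! (i - 1) - y"
      by simp
    then show "payoff A B C i (xs[i - 1 := y]) =
        B * (y * (residual_after d 0 (M - sum_list xs + xs ! (i - 1) - y) - d * y))"
      using i by (simp add: payoff_eq[of _ _ y])
  qed
  \<comment> \<open>Firms are numbered from 1, list positions from 0.\<close>
  have shift: "(\<forall>i\<in>{1..n}. P (i - 1)) \<longleftrightarrow> (\<forall>j<n. P j)" for P :: "nat \<Rightarrow> bool"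
  proof -
    have "{1..n} = Suc ` {..<n}"
      by (simp add: image_Suc_lessThan)
    then show ?thesis by (simp only: ball_simps diff_Suc_1) auto
  qed
  show ?thesis
    unfolding cournot_equilibrium_def
  proof (rule conj_cong[OF refl])
    assume xs: "xs \<in> output_vectors n"
    show "(\<forall>i\<in>{1..n}. is_arg_max (\<lambda>y. payoff A B C i (xs[i - 1 := y])) (\<lambda>y. 0 \<le> y)
            (xs ! (i - 1))) \<longleftrightarrow>
          (\<forall>j<n. xs ! j = best_reply d 0 (M - sum_list xs + xs ! j))"
      unfolding shift[symmetric] by (intro ball_cong refl reply xs)
  qed
qed

text \<open>
  Here \<open>r\<close> is the residual after all firms have produced. Eliminating the firm's own output
  \<open>x\<close> from the right-hand side of its best-reply equation expresses \<open>x\<close> through \<open>r\<close>, which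
  is the same for all firms.
\<close>

lemma best_reply_0_fixed_iff:
  assumes "0 \<le> x"
  shows "x = best_reply d 0 (r + x) \<longleftrightarrow> (1 + 2 * d) * x = max r 0"
proof -
  have "x = best_reply d 0 (r + x) \<longleftrightarrow> 2 * (1 + d) * x = max (r + x) 0"
    using d_nonneg by (auto simp: best_reply_def field_simps)
  also have "\<dots> \<longleftrightarrow> (1 + 2 * d) * x = max r 0"
  proof (cases "x = 0")
    case False
    then have "0 < 2 * (1 + d) * x" "0 < (1 + 2 * d) * x"
      using assms d_nonneg by (auto intro!: mult_pos_pos)
    then show ?thesis by (auto simp: max_def algebra_simps)
  qed simp
  finally show ?thesis .
qed

lemma is_cournot_aggregate_iff:
  "is_cournot_aggregate A B C n Q \<longleftrightarrow> M - Q = M * ((1 + 2 * d) / (real n + 1 + 2 * d))"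
proof
  assume "is_cournot_aggregate A B C n Q"
  then obtain xs where xs: "xs \<in> output_vectors n" and Q: "Q = sum_list xs"
    and reply: "\<And>j. j < n \<Longrightarrow> xs ! j = best_reply d 0 (M - Q + xs ! j)"
    unfolding is_cournot_aggregate_def cournot_iff_best_reply by blast
  have len: "length xs = n" using xs by (simp add: output_vectors_def)
  have "xs ! j = max (M - Q) 0 / (1 + 2 * d)" if "j < n" for j
  proof -
    have "0 \<le> xs ! j" using xs that by (auto simp: output_vectors_def)
    from best_reply_0_fixed_iff[OF this] reply[OF that]
    have "(1 + 2 * d) * xs ! j = max (M - Q) 0" by blast
    then show ?thesis using d_nonneg by (simp add: field_simps)
  qed
  then have "xs = replicate n (max (M - Q) 0 / (1 + 2 * d))"
    using len by (intro nth_equalityI) auto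
  then have Q': "Q = real n * (max (M - Q) 0 / (1 + 2 * d))"
    unfolding Q by (metis sum_list_replicate)
  \<comment> \<open>Otherwise nobody would produce, and the residual would be the positive \<open>M\<close>.\<close>
  have "0 < M - Q"
  proof (rule ccontr)
    assume "\<not> 0 < M - Q"
    then show False using Q' M_pos by simp
  qed
  then have "Q * (1 + 2 * d) = real n * (M - Q)"
    using Q' d_nonneg by (simp add: field_simps)
  then show "M - Q = M * ((1 + 2 * d) / (real n + 1 + 2 * d))"
    using d_nonneg by (simp add: field_simps)
next
  assume Q: "M - Q = M * ((1 + 2 * d) / (real n + 1 + 2 * d))"
  define x where "x = M / (real n + 1 + 2 * d)"
  define xs where "xs = replicate n x"
  have den: "0 < real n + 1 + 2 * d" using d_nonneg by simp
  then have x: "0 \<le> x" using M_pos by (simp add: x_def)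
  have r: "M - Q = (1 + 2 * d) * x"
    using Q by (simp add: x_def)
  have sum: "sum_list xs = Q"
  proof -
    have "(real n + 1 + 2 * d) * x = M" using den by (simp add: x_def)
    then show ?thesis using r by (simp add: xs_def sum_list_replicate algebra_simps)
  qed
  have reply: "x = best_reply d 0 (M - Q + x)"
    unfolding best_reply_0_fixed_iff[OF x] r using x d_nonneg by simp
  have nth: "xs ! j = x" if "j < n" for j
    using that by (simp add: xs_def)
  have "xs \<in> output_vectors n"
    using x by (auto simp: xs_def output_vectors_def)
  then have "cournot_equilibrium A B C n xs"
    unfolding cournot_iff_best_reply sum using reply nth by metis
  then show "is_cournot_aggregate A B C n Q"
    unfolding is_cournot_aggregate_def using sum by blast
qed

subsection \<open>Stackelberg\<close>

text \<open>
  Only the last \<open>m\<close> firms have to follow the formula: in the backward induction below, this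
  lemma is applied when the replies of the later firms are already known, but not those of the
  earlier ones.
\<close>

lemma residual_of_play:
  assumes "h \<in> output_vectors (n - m)" "m \<le> n"
    and "\<And>k h'. k \<in> {n - m + 1..n} \<Longrightarrow> h' \<in> output_vectors (k - 1) \<Longrightarrow>
           \<sigma> k h' = best_reply d (n - k) (M - sum_list h')"
  shows "M - sum_list (play \<sigma> m h) = residual_after d m (M - sum_list h)"
  using assms
proof (induction m arbitrary: h)
  case 0
  then show ?case by simp
next
  case (Suc m)
  let ?x = "\<sigma> (n - m) h"
  have len: "length h = n - Suc m" "n - m = Suc (length h)"
    using Suc.prems by (auto simp: output_vectors_def)
  have "?x = best_reply d (n - (n - m)) (M - sum_list h)"
    using Suc.prems by (intro Suc.prems(3)) auto
  then have x: "?x = best_reply d m (M - sum_list h)"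
    using Suc.prems by simp
  have "h @ [?x] \<in> output_vectors (n - m)"
    unfolding x using Suc.prems(1) len best_reply_nonneg[OF d_nonneg]
    by (auto simp: output_vectors_def)
  then have "M - sum_list (play \<sigma> m (h @ [?x])) = residual_after d m (M - sum_list (h @ [?x]))"
    using Suc.prems by (intro Suc.IH) auto
  then show ?case
    using residual_after_best_reply[OF d_nonneg, of m "M - sum_list h"] len(2) x
    by (simp add: algebra_simps)
qed

lemma best_reply_to_followers:
  assumes k: "k \<in> {1..n}" and h: "h \<in> output_vectors (k - 1)"
    and later: "\<And>j h'. j \<in> {k + 1..n} \<Longrightarrow> h' \<in> output_vectors (j - 1) \<Longrightarrow>
           \<sigma> j h' = best_reply d (n - j) (M - sum_list h')"
  shows "is_arg_max (\<lambda>y. payoff A B C k (play \<sigma> (n - k) (h @ [y]))) (\<lambda>y. 0 \<le> y) x \<longleftrightarrow>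
         x = best_reply d (n - k) (M - sum_list h)"
proof (rule is_arg_max_iff_best_reply[OF d_nonneg B_pos])
  fix y :: real
  assume "0 \<le> y"
  have len: "length h = k - 1" using h by (simp add: output_vectors_def)
  have "h @ [y] \<in> output_vectors (n - (n - k))"
    using h k \<open>0 \<le> y\<close> by (auto simp: output_vectors_def)
  then have "M - sum_list (play \<sigma> (n - k) (h @ [y])) =
      residual_after d (n - k) (M - sum_list (h @ [y]))"
    using k later by (intro residual_of_play[where n = n]) auto
  then have "M - sum_list (play \<sigma> (n - k) (h @ [y])) =
      residual_after d (n - k) (M - sum_list h - y)"
    by (simp add: diff_diff_eq)
  moreover have "play \<sigma> (n - k) (h @ [y]) ! (k - 1) = y"
    using len nth_play[of "k - 1" "h @ [y]"] nth_append_length[of h y "[]"] by simp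
  ultimately show "payoff A B C k (play \<sigma> (n - k) (h @ [y])) =
      B * (y * (residual_after d (n - k) (M - sum_list h - y) - d * y))"
    by (simp add: payoff_eq[of _ _ y])
qed

text \<open>
  Backward induction. The formula on the right also yields an equilibrium, so this
  characterization gives existence and uniqueness at once.
\<close>

lemma subgame_perfect_iff_best_reply:
  "subgame_perfect A B C n \<sigma> \<longleftrightarrow>
     (\<forall>k\<in>{1..n}. \<forall>h\<in>output_vectors (k - 1). \<sigma> k h = best_reply d (n - k) (M - sum_list h))"
  (is "_ \<longleftrightarrow> ?replies")
proof
  assume sp: "subgame_perfect A B C n \<sigma>"
  have "\<sigma> k h = best_reply d (n - k) (M - sum_list h)"
    if "k \<in> {1..n}" "h \<in> output_vectors (k - 1)" for k h
    using that
  proof (induction "n - k" arbitrary: k h rule: less_induct)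
    case less
    have "is_arg_max (\<lambda>y. payoff A B C k (play \<sigma> (n - k) (h @ [y]))) (\<lambda>y. 0 \<le> y) (\<sigma> k h)"
      using sp less.prems unfolding subgame_perfect_def by blast
    then show ?case
      using less by (subst (asm) best_reply_to_followers) auto
  qed
  then show ?replies by blast
next
  assume ?replies
  then show "subgame_perfect A B C n \<sigma>"
    unfolding subgame_perfect_def by (intro ballI iffD2[OF best_reply_to_followers]) auto
qed

lemma is_stackelberg_aggregate_iff:
  "is_stackelberg_aggregate A B C n Q \<longleftrightarrow> M - Q = M * residual_share d n"
proof -
  have path: "M - sum_list (play \<sigma> n []) = M * residual_share d n"
    if "subgame_perfect A B C n \<sigma>" for \<sigma>
  proof -
    have "M - sum_list (play \<sigma> n []) = residual_after d n (M - sum_list [])"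
      using that unfolding subgame_perfect_iff_best_reply
      by (intro residual_of_play[where n = n]) (auto simp: output_vectors_def)
    then show ?thesis using M_pos by (simp add: residual_after_def mult.commute)
  qed
  moreover have "subgame_perfect A B C n (\<lambda>k h. best_reply d (n - k) (M - sum_list h))"
    unfolding subgame_perfect_iff_best_reply by blast
  ultimately have "is_stackelberg_aggregate A B C n Q \<longleftrightarrow> Q = M - M * residual_share d n"
    unfolding is_stackelberg_aggregate_def by (metis eq_diff_eq diff_eq_eq add.commute)
  then show ?thesis by auto
qed

subsection \<open>Residuals\<close>

lemma ex1_cournot_aggregate: "\<exists>!Q. is_cournot_aggregate A B C n Q"
  unfolding is_cournot_aggregate_iff
  by (rule ex1I[of _ "M - M * ((1 + 2 * d) / (real n + 1 + 2 * d))"]) auto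

lemma ex1_stackelberg_aggregate: "\<exists>!Q. is_stackelberg_aggregate A B C n Q"
  unfolding is_stackelberg_aggregate_iff
  by (rule ex1I[of _ "M - M * residual_share d n"]) auto

lemma cournot_residual:
  "(M - cournot_aggregate A B C n) / M = (1 + 2 * d) / (real n + 1 + 2 * d)"
proof -
  have "is_cournot_aggregate A B C n (cournot_aggregate A B C n)"
    unfolding cournot_aggregate_def by (rule theI'[OF ex1_cournot_aggregate])
  then show ?thesis
    using M_pos unfolding is_cournot_aggregate_iff by simp
qed

lemma stackelberg_residual:
  "(M - stackelberg_aggregate A B C n) / M = residual_share d n"
proof -
  have "is_stackelberg_aggregate A B C n (stackelberg_aggregate A B C n)"
    unfolding stackelberg_aggregate_def by (rule theI'[OF ex1_stackelberg_aggregate])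
  then show ?thesis
    using M_pos unfolding is_stackelberg_aggregate_iff by simp
qed

end

theorem theorem15:
  fixes A B :: real
  assumes "A > 0" and "B > 0"
  shows
    "(\<forall>c. 0 \<le> c \<and> c < A \<longrightarrow>
       (let C = (\<lambda>(i::nat) x. c * x);
            M = (A - c) / B;
            RC = (\<lambda>n. (M - cournot_aggregate A B C n) / M);
            RS = (\<lambda>n. (M - stackelberg_aggregate A B C n) / M)
        in (\<forall>n. \<exists>!Q. is_cournot_aggregate A B C n Q) \<and>
           (\<forall>n. \<exists>!Q. is_stackelberg_aggregate A B C n Q) \<and>
           (\<forall>n. RC n = 1 / (real n + 1)) \<and>
           (\<forall>n. RS n = 1 / 2 ^ n) \<and>
           (\<lambda>n. RS n / RC n) \<longlonglongrightarrow> 0 \<and>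
           (\<lambda>n. (real n + 1) / 2 ^ n) \<longlonglongrightarrow> (0::real))) \<and>
     (\<forall>c>0.
       (let C = (\<lambda>(i::nat) x. c * x ^ 2);
            M = A / B;
            \<delta> = c / B;
            RC = (\<lambda>n. (M - cournot_aggregate A B C n) / M);
            RS = (\<lambda>n. (M - stackelberg_aggregate A B C n) / M)
        in (\<forall>n. \<exists>!Q. is_cournot_aggregate A B C n Q) \<and>
           (\<forall>n. \<exists>!Q. is_stackelberg_aggregate A B C n Q) \<and>
           (\<forall>n. RC n = (1 + 2 * \<delta>) / (real n + 1 + 2 * \<delta>)) \<and>
           RC \<sim>[at_top] (\<lambda>n. (1 + 2 * \<delta>) / real n) \<and>
           RS 0 = 1 \<and>
           (\<forall>n\<ge>1. RS n = RS (n - 1) * (RS (n - 1) + 2 * \<delta>) / (2 * (RS (n - 1) + \<delta>))) \<and>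
           RS \<sim>[at_top] (\<lambda>n. 2 * \<delta> / real n) \<and>
           (\<lambda>n. RS n / RC n) \<longlonglongrightarrow> 2 * \<delta> / (1 + 2 * \<delta>) \<and>
           2 * \<delta> / (1 + 2 * \<delta>) < 1))"
proof (intro conjI allI impI)
  fix c :: real
  assume c: "0 \<le> c \<and> c < A"
  \<comment> \<open>\<open>d = 0\<close>: the share is halved in each step.\<close>
  interpret linear: quadratic_oligopoly A B c 0 "\<lambda>i x. c * x"
    using assms c by unfold_locales auto
  have M: "linear.M = (A - c) / B" and d: "linear.d = 0"
    by (simp_all add: linear.M_def linear.d_def)
  note residuals = linear.cournot_residual[unfolded M d] linear.stackelberg_residual[unfolded M d]
  have ratio: "(\<lambda>n. (real n + 1) / 2 ^ n) \<longlonglongrightarrow> (0::real)"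
    by real_asymp
  show "let C = (\<lambda>(i::nat) x. c * x);
            M = (A - c) / B;
            RC = (\<lambda>n. (M - cournot_aggregate A B C n) / M);
            RS = (\<lambda>n. (M - stackelberg_aggregate A B C n) / M)
        in (\<forall>n. \<exists>!Q. is_cournot_aggregate A B C n Q) \<and>
           (\<forall>n. \<exists>!Q. is_stackelberg_aggregate A B C n Q) \<and>
           (\<forall>n. RC n = 1 / (real n + 1)) \<and>
           (\<forall>n. RS n = 1 / 2 ^ n) \<and>
           (\<lambda>n. RS n / RC n) \<longlonglongrightarrow> 0 \<and>
           (\<lambda>n. (real n + 1) / 2 ^ n) \<longlonglongrightarrow> (0::real)"
    unfolding Let_def residuals residual_share_zero
    using ratio linear.ex1_cournot_aggregate linear.ex1_stackelberg_aggregate by simp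
next
  fix c :: real
  assume c: "0 < c"
  interpret quadratic: quadratic_oligopoly A B 0 c "\<lambda>i x. c * x\<^sup>2"
    using assms c by unfold_locales auto
  have M: "quadratic.M = A / B" and d: "quadratic.d = c / B"
    by (simp_all add: quadratic.M_def quadratic.d_def)
  note residuals =
    quadratic.cournot_residual[unfolded M d] quadratic.stackelberg_residual[unfolded M d]
  define \<delta> where "\<delta> = c / B"
  have \<delta>: "0 < \<delta>" using c assms by (simp add: \<delta>_def)
  let ?RC = "\<lambda>n. (1 + 2 * \<delta>) / (real n + 1 + 2 * \<delta>)"
  have RC: "?RC \<sim>[at_top] (\<lambda>n. (1 + 2 * \<delta>) / real n)"
    using \<delta> by real_asymp
  have RS: "residual_share \<delta> \<sim>[at_top] (\<lambda>n. 2 * \<delta> / real n)"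
    using \<delta> by (rule residual_share_asymp)
  have "(\<lambda>n. residual_share \<delta> n / ?RC n)
      \<sim>[at_top] (\<lambda>n. (2 * \<delta> / real n) / ((1 + 2 * \<delta>) / real n))"
    by (intro asymp_equiv_intros RC RS)
  moreover have "(\<lambda>n. (2 * \<delta> / real n) / ((1 + 2 * \<delta>) / real n))
      \<longlonglongrightarrow> 2 * \<delta> / (1 + 2 * \<delta>)"
    by (rule tendsto_eventually, use eventually_gt_at_top[of 0] in eventually_elim) simp
  ultimately have ratio: "(\<lambda>n. residual_share \<delta> n / ?RC n) \<longlonglongrightarrow> 2 * \<delta> / (1 + 2 * \<delta>)"
    using tendsto_asymp_equiv_cong by blast
  have rec: "residual_share \<delta> n = residual_share \<delta> (n - 1) * (residual_share \<delta> (n - 1) + 2 * \<delta>)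
      / (2 * (residual_share \<delta> (n - 1) + \<delta>))" if "1 \<le> n" for n
    using that by (cases n) auto
  show "let C = (\<lambda>(i::nat) x. c * x ^ 2);
            M = A / B;
            \<delta> = c / B;
            RC = (\<lambda>n. (M - cournot_aggregate A B C n) / M);
            RS = (\<lambda>n. (M - stackelberg_aggregate A B C n) / M)
        in (\<forall>n. \<exists>!Q. is_cournot_aggregate A B C n Q) \<and>
           (\<forall>n. \<exists>!Q. is_stackelberg_aggregate A B C n Q) \<and>
           (\<forall>n. RC n = (1 + 2 * \<delta>) / (real n + 1 + 2 * \<delta>)) \<and>
           RC \<sim>[at_top] (\<lambda>n. (1 + 2 * \<delta>) / real n) \<and>
           RS 0 = 1 \<and>
           (\<forall>n\<ge>1. RS n = RS (n - 1) * (RS (n - 1) + 2 * \<delta>) / (2 * (RS (n - 1) + \<delta>))) \<and>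
           RS \<sim>[at_top] (\<lambda>n. 2 * \<delta> / real n) \<and>
           (\<lambda>n. RS n / RC n) \<longlonglongrightarrow> 2 * \<delta> / (1 + 2 * \<delta>) \<and>
           2 * \<delta> / (1 + 2 * \<delta>) < 1"
    unfolding Let_def residuals \<delta>_def[symmetric]
  proof (intro conjI allI impI)
    show "2 * \<delta> / (1 + 2 * \<delta>) < 1" using \<delta> by simp
  qed (use RC RS ratio rec quadratic.ex1_cournot_aggregate
        quadratic.ex1_stackelberg_aggregate in \<open>simp_all del: residual_share.simps(2)\<close>)
qed

end
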